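(* Let $\mathcal{A}\in\mathbb{R}^{n_1\times\cdots\times n_d}$ be an order-$d$ real tensor with multilinear rank $\mathrm{rank}_{\boxplus}(\mathcal{A})=(r_1,\ldots,r_d)$. Then $$\mathrm{rank}_{\boxplus}(\mathbf{sym}(\mathcal{A}))=(R,\ldots,R),\qquad\text{where } R=r_1+\cdots+r_d.$$
   Context: An order-$d$ tensor $\mathcal{A}\in\mathbb{R}^{n_1\times\cdots\times n_d}$ is a real $d$-dimensional array with entries $\mathcal{A}(\mathbf{i})=\mathcal{A}(i_1,\ldots,i_d)$, $1\le i_k\le n_k$. Transposition: for a permutation $\mathbf{p}=[p_1,\ldots,p_d]$ of $1,\ldots,d$, $\mathcal{A}^{<\mathbf{p}>}\in\mathbb{R}^{n_{p_1}\times\cdots\times n_{p_d}}$ is defined by $\mathcal{A}^{<\mathbf{p}>}(j_{p_1},\ldots,j_{p_d})=\mathcal{A}(j_1,\ldots,j_d)$ for $1\le j_k\le n_k$. Symmetric embedding: let $N=n_1+\cdots+n_d$ and partition the index range $1,\ldots,N$ into consecutive ranges $\mathbf{r}_1,\ldots,\mathbf{r}_d$ with $\mathbf{r}_k = (1+n_1+\cdots+n_{k-1}),\ldots,(n_1+\cdots+n_k)$. Then $\mathcal{C}=\mathbf{sym}(\mathcal{A})$ is the order-$d$ tensor in $\mathbb{R}^{N\times\cdots\times N}$ whose blocks $\mathcal{C}_{\mathbf{i}}=\mathcal{C}(\mathbf{r}_{i_1},\ldots,\mathbf{r}_{i_d})$, $1\le i_k\le d$, are $\mathcal{C}_{\mathbf{i}}=\mathcal{A}^{<\mathbf{i}>}$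 if $\mathbf{i}=[i_1,\ldots,i_d]$ is a permutation of $1,\ldots,d$, and $\mathcal{C}_{\mathbf{i}}=0$ otherwise. Modal unfolding: for index vectors $\mathbf{i},\mathbf{s}$ of length $e$, $ivec(\mathbf{i},\mathbf{s})=i_1+(i_2-1)s_1+\cdots+(i_e-1)(s_1\cdots s_{e-1})$. The mode-$k$ unfolding $\mathcal{A}_{(k)}$ is the matrix with $n_k$ rows and $\prod_{j\ne k}n_j$ columns given by $\mathcal{A}_{(k)}(i_k,ivec(\tilde{\mathbf{i}},\tilde{\mathbf{n}}))=\mathcal{A}(\mathbf{i})$, where $\tilde{\mathbf{i}},\tilde{\mathbf{n}}$ are $\mathbf{i}=[i_1,\ldots,i_d]$, $\mathbf{n}=[n_1,\ldots,n_d]$ with the $k$-th entry deleted. Multilinear rank: $\mathrm{rank}_{\boxplus}(\mathcal{A})=(\mathrm{rank}(\mathcal{A}_{(1)}),\ldots,\mathrm{rank}(\mathcal{A}_{(d)}))$. *)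

theory Defs
  imports "Jordan_Normal_Form.DL_Rank"
begin

section \<open>Tensors\<close>

text \<open>
  All indices, modes and permutations are counted from 0. A multi-index of a tensor with dimensions
  \<open>ns = [n_0, \<dots>, n_(d-1)]\<close> is a list of the same length.
\<close>

definition index_set :: "nat list \<Rightarrow> nat list set" where
  "index_set ns = {i. length i = length ns \<and> (\<forall>k < length ns. i ! k < ns ! k)}"

text \<open>
  As for the type of matrices, the entry function has a fixed value outside the index range, so that
  tensors are equal iff they have the same dimensions and the same entries.
\<close>

typedef 'a tensor = "{(ns :: nat list, f :: nat list \<Rightarrow> 'a). \<forall>i. i \<notin> index_set ns \<longrightarrow> f i = undefined}"
  by (rule exI[of _ "([], \<lambda>_. undefined)"]) simp

definition dims :: "'a tensor \<Rightarrow> nat list" where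
  "dims A = fst (Rep_tensor A)"

definition entry :: "'a tensor \<Rightarrow> nat list \<Rightarrow> 'a" where
  "entry A = snd (Rep_tensor A)"

definition mk_tensor :: "nat list \<Rightarrow> (nat list \<Rightarrow> 'a) \<Rightarrow> 'a tensor" where
  "mk_tensor ns f = Abs_tensor (ns, \<lambda>i. if i \<in> index_set ns then f i else undefined)"

lemma Rep_mk_tensor:
  "Rep_tensor (mk_tensor ns f) = (ns, \<lambda>i. if i \<in> index_set ns then f i else undefined)"
  unfolding mk_tensor_def by (rule Abs_tensor_inverse) simp

lemma dims_mk_tensor [simp]: "dims (mk_tensor ns f) = ns"
  by (simp add: dims_def Rep_mk_tensor)

lemma entry_mk_tensor [simp]: "i \<in> index_set ns \<Longrightarrow> entry (mk_tensor ns f) i = f i"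
  by (simp add: entry_def Rep_mk_tensor)

lemma tensor_eqI:
  assumes "dims A = dims B" "\<And>i. i \<in> index_set (dims A) \<Longrightarrow> entry A i = entry B i"
  shows "A = B"
proof -
  have *: "entry C i = undefined" if "i \<notin> index_set (dims C)" for C :: "'a tensor" and i
    using that Rep_tensor[of C] by (auto simp: entry_def dims_def)
  have "entry A = entry B"
  proof
    fix i show "entry A i = entry B i"
      using assms *[of i A] *[of i B] by (cases "i \<in> index_set (dims A)") auto
  qed
  with assms(1) show ?thesis
    by (metis Rep_tensor_inject dims_def entry_def prod_eq_iff)
qed

section \<open>Transposition\<close>

definition is_perm :: "nat \<Rightarrow> nat list \<Rightarrow> bool" where
  "is_perm d p \<longleftrightarrow> distinct p \<and> set p = {..<d}"

text \<open>The entry of the transpose at \<open>[j_(p_0), \<dots>, j_(p_(d-1))]\<close> is the entry of \<open>A\<close> at \<open>j\<close>.\<close>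

definition tensor_transpose :: "nat list \<Rightarrow> 'a tensor \<Rightarrow> 'a tensor" where
  "tensor_transpose p A = mk_tensor (map (\<lambda>k. dims A ! k) p)
     (\<lambda>l. entry A (THE j. j \<in> index_set (dims A) \<and> map (\<lambda>k. j ! k) p = l))"

lemma entry_tensor_transpose:
  assumes p: "is_perm (length (dims A)) p" and j: "j \<in> index_set (dims A)"
  shows "entry (tensor_transpose p A) (map (\<lambda>k. j ! k) p) = entry A j"
proof -
  have lp: "\<And>m. m < length p \<Longrightarrow> p ! m < length (dims A)"
    using p nth_mem by (fastforce simp: is_perm_def)
  have "(THE i. i \<in> index_set (dims A) \<and> map (\<lambda>k. i ! k) p = map (\<lambda>k. j ! k) p) = j"
  proof (rule the_equality)
    fix i assume i: "i \<in> index_set (dims A) \<and> map (\<lambda>k. i ! k) p = map (\<lambda>k. j ! k) p"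
    then show "i = j"
      using p j by (intro nth_equalityI) (auto simp: is_perm_def index_set_def)
  qed (use j in simp)
  moreover have "map (\<lambda>k. j ! k) p \<in> index_set (map (\<lambda>k. dims A ! k) p)"
    using j lp by (auto simp: index_set_def)
  ultimately show ?thesis
    by (simp add: tensor_transpose_def)
qed

section \<open>Symmetric embedding\<close>

definition range_start :: "nat list \<Rightarrow> nat \<Rightarrow> nat" where
  "range_start ns k = sum_list (take k ns)"

definition index_range :: "nat list \<Rightarrow> nat \<Rightarrow> nat set" where
  "index_range ns k = {range_start ns k ..< range_start ns (Suc k)}"

definition range_of :: "nat list \<Rightarrow> nat \<Rightarrow> nat" where
  "range_of ns x = (THE k. k < length ns \<and> x \<in> index_range ns k)"

text \<open>
  The entry of the embedding at \<open>c\<close> lies in the block \<open>b\<close> whose \<open>m\<close>-th component is the number of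
  the range containing \<open>c_m\<close>; its position inside that block is \<open>c\<close> minus the starts of the ranges.
\<close>

definition sym_embedding :: "'a :: zero tensor \<Rightarrow> 'a tensor" where
  "sym_embedding A = (let ns = dims A; d = length ns; N = sum_list ns in
     mk_tensor (replicate d N)
       (\<lambda>c. let b = map (range_of ns) c in
         if is_perm d b
         then entry (tensor_transpose b A) (map (\<lambda>x. x - range_start ns (range_of ns x)) c)
         else 0))"

lemma range_start_Suc:
  "k < length ns \<Longrightarrow> range_start ns (Suc k) = range_start ns k + ns ! k"
  by (simp add: range_start_def take_Suc_conv_app_nth)

lemma range_start_mono:
  assumes "k \<le> l" shows "range_start ns k \<le> range_start ns l"
proof -
  from assms obtain m where "l = k + m" using le_Suc_ex by blast
  then show ?thesis by (simp add: range_start_def take_add)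
qed

lemma range_of_eq:
  assumes k: "k < length ns" and x: "x < ns ! k"
  shows "range_of ns (range_start ns k + x) = k"
  unfolding range_of_def
proof (rule the_equality)
  show "k < length ns \<and> range_start ns k + x \<in> index_range ns k"
    using k x by (simp add: index_range_def range_start_Suc)
next
  fix l assume l: "l < length ns \<and> range_start ns k + x \<in> index_range ns l"
  show "l = k"
  proof (rule ccontr)
    assume "l \<noteq> k"
    then consider "Suc l \<le> k" | "Suc k \<le> l" by linarith
    then show False
    proof cases
      case 1
      then show ?thesis using range_start_mono[OF 1, of ns] l by (auto simp: index_range_def)
    next
      case 2
      then show ?thesis using range_start_mono[OF 2, of ns] l k x
        by (auto simp: index_range_def range_start_Suc)
    qed
  qed
qed

lemma dims_sym_embedding [simp]:
  "dims (sym_embedding A) = replicate (length (dims A)) (sum_list (dims A))"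
  by (simp add: sym_embedding_def Let_def)

lemma entry_sym_embedding:
  assumes b: "length b = length (dims A)" "set b \<subseteq> {..<length (dims A)}"
    and j: "j \<in> index_set (map (\<lambda>k. dims A ! k) b)"
  shows "entry (sym_embedding A) (map2 (\<lambda>k x. range_start (dims A) k + x) b j) =
    (if is_perm (length (dims A)) b then entry (tensor_transpose b A) j else 0)"
proof -
  let ?ns = "dims A" and ?c = "map2 (\<lambda>k x. range_start (dims A) k + x) b j"
  have lj: "length j = length b" using j by (simp add: index_set_def)
  have bm: "b ! m < length ?ns" if "m < length b" for m
    using b that nth_mem by blast
  have jm: "j ! m < ?ns ! (b ! m)" if "m < length b" for m
    using j that by (simp add: index_set_def)
  have 1: "map (range_of ?ns) ?c = b"
    using lj bm jm by (intro nth_equalityI) (auto simp: range_of_eq)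
  have 2: "map (\<lambda>x. x - range_start ?ns (range_of ?ns x)) ?c = j"
    using lj bm jm by (intro nth_equalityI) (auto simp: range_of_eq)
  have "range_start ?ns (b ! m) + j ! m < sum_list ?ns" if m: "m < length b" for m
  proof -
    have "range_start ?ns (b ! m) + j ! m < range_start ?ns (Suc (b ! m))"
      using bm[OF m] jm[OF m] by (simp add: range_start_Suc)
    also have "\<dots> \<le> range_start ?ns (length ?ns)"
      using bm[OF m] by (intro range_start_mono) simp
    finally show ?thesis by (simp add: range_start_def)
  qed
  then have "?c \<in> index_set (replicate (length ?ns) (sum_list ?ns))"
    using lj b by (auto simp: index_set_def)
  then show ?thesis
    by (simp add: sym_embedding_def Let_def 1 2 del: map_map)
qed

section \<open>Modal unfoldings and multilinear rank\<close>

definition ivec :: "nat list \<Rightarrow> nat list \<Rightarrow> nat" where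
  "ivec i s = (\<Sum>k < length s. i ! k * prod_list (take k s))"

definition delete_nth :: "nat \<Rightarrow> 'a list \<Rightarrow> 'a list" where
  "delete_nth k xs = take k xs @ drop (Suc k) xs"

definition unfolding_mat :: "nat \<Rightarrow> 'a tensor \<Rightarrow> 'a mat" where
  "unfolding_mat k A = (let ns = dims A in
     mat (ns ! k) (prod_list (delete_nth k ns))
       (\<lambda>(r, c). entry A (THE i. i \<in> index_set ns \<and> i ! k = r \<and>
                                 ivec (delete_nth k i) (delete_nth k ns) = c)))"

definition multilinear_rank :: "'a :: field tensor \<Rightarrow> nat list" where
  "multilinear_rank A =
     map (\<lambda>k. vec_space.rank (dims A ! k) (unfolding_mat k A)) [0..<length (dims A)]"

lemma index_set_Nil: "index_set [] = {[]}"
  by (auto simp: index_set_def)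

lemma index_set_Cons: "index_set (n # ns) = {x # i |x i. x < n \<and> i \<in> index_set ns}"
proof (intro equalityI subsetI)
  fix j assume "j \<in> index_set (n # ns)"
  then show "j \<in> {x # i |x i. x < n \<and> i \<in> index_set ns}"
    by (cases j) (auto simp: index_set_def All_less_Suc2)
qed (auto simp: index_set_def All_less_Suc2)

lemma ivec_Cons: "ivec (x # i) (n # s) = x + n * ivec i s"
  by (simp add: ivec_def sum.lessThan_Suc_shift sum_distrib_left ac_simps del: sum.lessThan_Suc)

lemma bij_betw_ivec: "bij_betw (\<lambda>i. ivec i s) (index_set s) {..<prod_list s}"
proof (induction s)
  case Nil
  then show ?case by (simp add: index_set_Nil ivec_def bij_betw_def lessThan_Suc)
next
  case (Cons n s)
  have inj: "inj_on (\<lambda>i. ivec i s) (index_set s)"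
    and img: "(\<lambda>i. ivec i s) ` index_set s = {..<prod_list s}"
    using Cons by (auto simp: bij_betw_def)
  show ?case
  proof (rule bij_betw_imageI)
    show "inj_on (\<lambda>i. ivec i (n # s)) (index_set (n # s))"
    proof (rule inj_onI)
      fix i j assume i: "i \<in> index_set (n # s)" and j: "j \<in> index_set (n # s)"
        and eq: "ivec i (n # s) = ivec j (n # s)"
      obtain x i' where ii: "i = x # i'" "x < n" "i' \<in> index_set s"
        using i by (auto simp: index_set_Cons)
      obtain y j' where jj: "j = y # j'" "y < n" "j' \<in> index_set s"
        using j by (auto simp: index_set_Cons)
      have e: "x + n * ivec i' s = y + n * ivec j' s"
        using eq by (simp add: ii jj ivec_Cons)
      have "(x + n * ivec i' s) mod n = x" "(y + n * ivec j' s) mod n = y"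
        using ii jj by simp_all
      then have xy: "x = y" using e by simp
      then have "ivec i' s = ivec j' s" using e ii by simp
      then have "i' = j'" using inj ii jj by (auto dest: inj_onD)
      with xy show "i = j" by (simp add: ii jj)
    qed
    show "(\<lambda>i. ivec i (n # s)) ` index_set (n # s) = {..<prod_list (n # s)}"
    proof (intro equalityI subsetI)
      fix c assume "c \<in> (\<lambda>i. ivec i (n # s)) ` index_set (n # s)"
      then obtain x i where xi: "x < n" "i \<in> index_set s" "c = x + n * ivec i s"
        by (auto simp: index_set_Cons ivec_Cons)
      then have "ivec i s < prod_list s" using img by auto
      then have "n * Suc (ivec i s) \<le> n * prod_list s" by (intro mult_left_mono) auto
      then show "c \<in> {..<prod_list (n # s)}" using xi by simp
    next
      fix c assume c: "c \<in> {..<prod_list (n # s)}"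
      then have "n > 0" by (cases n) auto
      have "c div n < prod_list s"
        using c by (simp add: less_mult_imp_div_less mult.commute)
      then obtain i where i: "i \<in> index_set s" "ivec i s = c div n"
        using img by (metis imageE lessThan_iff)
      have "ivec (c mod n # i) (n # s) = c"
        by (simp add: ivec_Cons i)
      moreover have "c mod n # i \<in> index_set (n # s)"
        using i \<open>n > 0\<close> by (auto simp: index_set_Cons)
      ultimately show "c \<in> (\<lambda>i. ivec i (n # s)) ` index_set (n # s)"
        by (metis imageI)
    qed
  qed
qed

lemma delete_nth_index_set:
  assumes "i \<in> index_set ns" "k < length ns"
  shows "delete_nth k i \<in> index_set (delete_nth k ns)"
  using assms by (auto simp: index_set_def delete_nth_def nth_append)

lemma unfolding_mat_index:
  assumes i: "i \<in> index_set (dims A)" and k: "k < length (dims A)"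
  shows "unfolding_mat k A $$ (i ! k, ivec (delete_nth k i) (delete_nth k (dims A))) = entry A i"
proof -
  let ?ns = "dims A"
  have "(THE j. j \<in> index_set ?ns \<and> j ! k = i ! k \<and>
      ivec (delete_nth k j) (delete_nth k ?ns) = ivec (delete_nth k i) (delete_nth k ?ns)) = i"
  proof (rule the_equality)
    fix j assume j: "j \<in> index_set ?ns \<and> j ! k = i ! k \<and>
      ivec (delete_nth k j) (delete_nth k ?ns) = ivec (delete_nth k i) (delete_nth k ?ns)"
    then have "delete_nth k j = delete_nth k i"
      using bij_betw_ivec[of "delete_nth k ?ns"] delete_nth_index_set i k
      by (auto simp: bij_betw_def dest: inj_onD)
    moreover have l: "length j = length ?ns" "length i = length ?ns"
      using i j by (auto simp: index_set_def)
    ultimately have "take k j = take k i" "drop (Suc k) j = drop (Suc k) i"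
      by (auto simp: delete_nth_def)
    then show "j = i"
      using j l k by (metis id_take_nth_drop)
  qed (use i in simp)
  moreover have "i ! k < ?ns ! k" using i k by (simp add: index_set_def)
  moreover have "ivec (delete_nth k i) (delete_nth k ?ns) < prod_list (delete_nth k ?ns)"
    using bij_betw_ivec[of "delete_nth k ?ns"] delete_nth_index_set[OF i k]
    by (auto simp: bij_betw_def)
  ultimately show ?thesis
    by (simp add: unfolding_mat_def Let_def)
qed

end

theory Submission
  imports Defs
begin

text \<open>
  Every column of a mode-\<open>m\<close> unfolding of \<open>sym_embedding A\<close> is either zero or a mode-\<open>k\<close> fibre of \<open>A\<close>
  placed in block \<open>k\<close> of a vector of length \<open>N\<close>, and every fibre of \<open>A\<close> in every mode arises in this
  way. The column space is therefore the direct sum of the column spaces of all unfoldings of \<open>A\<close>.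
\<close>

section \<open>Linear independence and rank\<close>

text \<open>A coordinatewise form of \<open>lin_indpt\<close>, free of the locale \<open>vec_space\<close>, which fixes the dimension:
  the blocks have different dimensions.\<close>

definition indpt_vecs :: "nat \<Rightarrow> 'a :: field vec set \<Rightarrow> bool" where
  "indpt_vecs n S \<longleftrightarrow> (\<forall>a. (\<forall>i<n. (\<Sum>v\<in>S. a v * v $ i) = 0) \<longrightarrow> (\<forall>v\<in>S. a v = 0))"

lemma indpt_vecsD:
  assumes "indpt_vecs n S" "\<And>i. i < n \<Longrightarrow> (\<Sum>v\<in>S. a v * v $ i) = 0" "v \<in> S"
  shows "a v = 0"
  using assms unfolding indpt_vecs_def by blast

lemma (in vec_space) lin_indpt_iff_indpt_vecs:
  assumes "finite S" "S \<subseteq> carrier_vec n"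
  shows "lin_indpt S \<longleftrightarrow> indpt_vecs n S"
proof -
  have zero: "lincomb a S = 0\<^sub>v n \<longleftrightarrow> (\<forall>i<n. (\<Sum>v\<in>S. a v * v $ i) = 0)" for a
  proof
    assume "lincomb a S = 0\<^sub>v n"
    then show "\<forall>i<n. (\<Sum>v\<in>S. a v * v $ i) = 0"
      using lincomb_index[OF _ assms(2)] by (metis index_zero_vec(1))
  next
    assume "\<forall>i<n. (\<Sum>v\<in>S. a v * v $ i) = 0"
    then show "lincomb a S = 0\<^sub>v n"
      using lincomb_index[OF _ assms(2)] lincomb_dim[OF assms] by (intro eq_vecI) auto
  qed
  show ?thesis
  proof
    assume li: "lin_indpt S"
    show "indpt_vecs n S"
      unfolding indpt_vecs_def
    proof (intro allI impI ballI, rule ccontr)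
      fix a v assume "\<forall>i<n. (\<Sum>v\<in>S. a v * v $ i) = 0" "v \<in> S" "a v \<noteq> 0"
      then have "lincomb a S = 0\<^sub>v n" using zero by blast
      then have "lin_dep S"
        using \<open>v \<in> S\<close> \<open>a v \<noteq> 0\<close>
        by (intro lin_dep_crit[where a = a and v = v, OF assms(1) subset_refl]) simp_all
      with li show False by simp
    qed
  next
    assume I: "indpt_vecs n S"
    show "lin_indpt S"
    proof
      assume "lin_dep S"
      then obtain a v where "lincomb a S = 0\<^sub>v n" and v: "v \<in> S" "a v \<noteq> 0"
        using finite_lin_dep[OF assms(1)] assms(2) by auto
      then have "\<forall>i<n. (\<Sum>v\<in>S. a v * v $ i) = 0" using zero by blast
      then show False using I v unfolding indpt_vecs_def by blast
    qed
  qed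
qed

text \<open>A relation on \<open>S\<close> becomes a relation on \<open>T\<close> once its
  coefficients are extended by zero.\<close>

lemma indpt_vecs_subset:
  assumes "indpt_vecs n T" "S \<subseteq> T" "finite T"
  shows "indpt_vecs n S"
  unfolding indpt_vecs_def
proof (intro allI impI ballI)
  fix a u assume a: "\<forall>i<n. (\<Sum>v\<in>S. a v * v $ i) = 0" and u: "u \<in> S"
  let ?b = "\<lambda>v. if v \<in> S then a v else 0"
  have "?b u = 0"
  proof (rule indpt_vecsD[OF assms(1), of ?b u])
    fix i assume "i < n"
    have "(\<Sum>v\<in>T. ?b v * v $ i) = (\<Sum>v\<in>S. a v * v $ i)"
      using assms by (intro sum.mono_neutral_cong_right) auto
    then show "(\<Sum>v\<in>T. ?b v * v $ i) = 0" using a \<open>i < n\<close> by metis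
  qed (use u assms(2) in blast)
  then show "a u = 0" using u by simp
qed

lemma zero_not_in_indpt_vecs:
  assumes "indpt_vecs n (S :: 'a :: field vec set)" "finite S"
  shows "0\<^sub>v n \<notin> S"
proof
  assume "0\<^sub>v n \<in> S"
  then have "indpt_vecs n {0\<^sub>v n :: 'a vec}"
    by (intro indpt_vecs_subset[OF assms(1) _ assms(2)]) simp
  from indpt_vecsD[OF this, of "\<lambda>_. 1" "0\<^sub>v n"] show False by simp
qed

text \<open>Independence passes to subsets, so the failure of all one-vector extensions already
  makes \<open>S\<close> maximal for inclusion. Only the set of columns enters, so order and
  repetition of columns do not affect the rank.\<close>

lemma rank_eq_card:
  assumes A: "A \<in> carrier_mat n nc" and S: "S \<subseteq> set (cols A)" "indpt_vecs n S"
    and max: "\<And>v. v \<in> set (cols A) \<Longrightarrow> v \<notin> S \<Longrightarrow> \<not> indpt_vecs n (insert v S)"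
  shows "vec_space.rank n A = card S"
proof (rule vec_space.rank_card_indpt[OF A])
  have C: "set (cols A) \<subseteq> carrier_vec n" using A cols_dim by blast
  have iff: "module.lin_dep class_ring (module_vec TYPE('a) n) T \<longleftrightarrow> \<not> indpt_vecs n T"
    if "T \<subseteq> set (cols A)" for T
    using vec_space.lin_indpt_iff_indpt_vecs[of T n] that C finite_subset[OF that] by auto
  show "maximal S (\<lambda>T. T \<subseteq> set (cols A) \<and> \<not> module.lin_dep class_ring (module_vec TYPE('a) n) T)"
    unfolding maximal_def
  proof (intro conjI allI impI; (elim conjE)?)
    fix B assume B: "S \<subseteq> B" "B \<subseteq> set (cols A)" "\<not> module.lin_dep class_ring (module_vec TYPE('a) n) B"
    show "B = S"
    proof (rule ccontr)
      assume "B \<noteq> S"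
      then obtain v where "v \<in> B" "v \<notin> S" using B(1) by blast
      moreover have "indpt_vecs n (insert v S)"
        using B iff[OF B(2)] \<open>v \<in> B\<close> finite_subset[OF B(2)]
        by (intro indpt_vecs_subset[where T = B and S = "insert v S"]) blast+
      ultimately show False using max B(2) by blast
    qed
  qed (use S iff in auto)
qed

lemma rank_obtain_basis:
  assumes A: "(A :: 'a :: field mat) \<in> carrier_mat n nc"
  obtains S where "S \<subseteq> set (cols A)" "indpt_vecs n S"
    "\<And>v. v \<in> set (cols A) \<Longrightarrow> v \<notin> S \<Longrightarrow> \<not> indpt_vecs n (insert v S)"
    "vec_space.rank n A = card S"
proof -
  let ?P = "\<lambda>T. T \<subseteq> set (cols A) \<and> indpt_vecs n T"
  \<comment> \<open>The empty set is the independent subset that is enlarged to a maximal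
    one.\<close>
  have "?P {}" by (simp add: indpt_vecs_def)
  then obtain S where S: "maximal S ?P"
    using maximal_exists_superset[of "set (cols A)" ?P "{}"] by blast
  then have 1: "S \<subseteq> set (cols A)" "indpt_vecs n S"
    and 2: "\<And>v. v \<in> set (cols A) \<Longrightarrow> v \<notin> S \<Longrightarrow> \<not> indpt_vecs n (insert v S)"
    unfolding maximal_def by blast+
  with rank_eq_card[OF A 1 2] show ?thesis using that by blast
qed

section \<open>Vectors supported in one block\<close>

text \<open>The embedding of the \<open>k\<close>-th summand into the direct sum of all blocks. The
  truncated subtraction is harmless: it is read only for \<open>x\<close> in range \<open>k\<close>,
  hence not below \<open>range_start ns k\<close>.\<close>

definition block_vec :: "nat list \<Rightarrow> nat \<Rightarrow> 'a :: zero vec \<Rightarrow> 'a vec" where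
  "block_vec ns k w = vec (sum_list ns)
     (\<lambda>x. if range_of ns x = k then w $ (x - range_start ns k) else 0)"

lemma range_start_add_less:
  assumes "k < length ns" "x < ns ! k"
  shows "range_start ns k + x < sum_list ns"
proof -
  have "range_start ns k + x < range_start ns (Suc k)"
    using assms by (simp add: range_start_Suc)
  also have "\<dots> \<le> range_start ns (length ns)"
    using assms by (intro range_start_mono) simp
  finally show ?thesis by (simp add: range_start_def)
qed

text \<open>Peeling off the first range at a time shows that the ranges cover all coordinates, so
  vectors of length \<open>sum_list ns\<close> can be compared block by block.\<close>

lemma obtain_range:
  assumes "x < sum_list ns"
  obtains k y where "k < length ns" "y < ns ! k" "x = range_start ns k + y"
proof -
  have "\<exists>k y. k < length ns \<and> y < ns ! k \<and> x = range_start ns k + y"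
    using assms
  proof (induction ns arbitrary: x)
    case (Cons n ns)
    show ?case
    proof (cases "x < n")
      case True
      then show ?thesis by (intro exI[of _ 0] exI[of _ x]) (simp add: range_start_def)
    next
      case False
      then have "x - n < sum_list ns" using Cons.prems by simp
      then obtain k y where "k < length ns" "y < ns ! k" "x - n = range_start ns k + y"
        using Cons.IH by blast
      then show ?thesis
        using False by (intro exI[of _ "Suc k"] exI[of _ y]) (auto simp: range_start_def)
    qed
  qed simp
  then show ?thesis using that by blast
qed

lemma block_vec_index:
  assumes "l < length ns" "x < ns ! l"
  shows "block_vec ns k w $ (range_start ns l + x) = (if l = k then w $ x else 0)"
  using assms range_start_add_less[OF assms] by (auto simp: block_vec_def range_of_eq)

lemma dim_block_vec [simp]: "dim_vec (block_vec ns k w) = sum_list ns"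
  by (simp add: block_vec_def)

lemma block_vec_eqI:
  assumes "dim_vec v = sum_list ns"
    and "\<And>l x. l < length ns \<Longrightarrow> x < ns ! l \<Longrightarrow>
      v $ (range_start ns l + x) = (if l = k then w $ x else 0)"
  shows "v = block_vec ns k w"
proof (rule eq_vecI)
  fix x assume "x < dim_vec (block_vec ns k w)"
  then show "v $ x = block_vec ns k w $ x"
    by (metis assms(2) block_vec_index dim_block_vec obtain_range)
qed (use assms in simp)

lemma inj_on_block_vec:
  assumes "k < length ns"
  shows "inj_on (block_vec ns k) (carrier_vec (ns ! k))"
proof (rule inj_onI)
  fix v w :: "'a vec" assume *: "v \<in> carrier_vec (ns ! k)" "w \<in> carrier_vec (ns ! k)"
    "block_vec ns k v = block_vec ns k w"
  show "v = w"
  proof (rule eq_vecI)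
    fix x assume "x < dim_vec w"
    then show "v $ x = w $ x"
      using block_vec_index[OF assms, of x k v] block_vec_index[OF assms, of x k w] * by auto
  qed (use * in auto)
qed

text \<open>A nonzero vector leaves a nonzero entry in its own block, where anything embedded from
  another block vanishes.\<close>

lemma block_vec_inj:
  assumes k: "k < length ns" "l < length ns"
    and v: "v \<in> carrier_vec (ns ! k)" "v \<noteq> 0\<^sub>v (ns ! k)" and w: "w \<in> carrier_vec (ns ! l)"
    and eq: "block_vec ns k v = block_vec ns l w"
  shows "k = l"
proof (rule ccontr)
  assume "k \<noteq> l"
  have "v = 0\<^sub>v (ns ! k)"
  proof (rule eq_vecI)
    fix x assume "x < dim_vec (0\<^sub>v (ns ! k))"
    then show "v $ x = 0\<^sub>v (ns ! k) $ x"
      using \<open>k \<noteq> l\<close> block_vec_index[OF k(1), of x k v] block_vec_index[OF k(1), of x l w] eq by simp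
  qed (use v in simp)
  with v show False by simp
qed

text \<open>A relation on \<open>S\<close> carries over to the images, because all other blocks
  contribute zeros. This later brings maximality inside one block to bear on the glued
  system.\<close>

lemma indpt_vecs_block_vec_imageD:
  assumes k: "k < length ns" and S: "S \<subseteq> carrier_vec (ns ! k)"
    and ind: "indpt_vecs (sum_list ns) (block_vec ns k ` S)"
  shows "indpt_vecs (ns ! k) S"
  unfolding indpt_vecs_def
proof (intro allI impI)
  fix a assume a: "\<forall>i<ns ! k. (\<Sum>v\<in>S. a v * v $ i) = 0"
  have inj: "inj_on (block_vec ns k) S"
    using inj_on_block_vec[OF k] S inj_on_subset by blast
  \<comment> \<open>Each image inherits the coefficient of its preimage, which is unique by
    injectivity.\<close>
  let ?b = "\<lambda>v. a (inv_into S (block_vec ns k) v)"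
  have sum_eq: "(\<Sum>v\<in>block_vec ns k ` S. ?b v * v $ i) = (\<Sum>v\<in>S. a v * block_vec ns k v $ i)" for i
    using inj by (simp add: sum.reindex)
  have "(\<Sum>v\<in>block_vec ns k ` S. ?b v * v $ i) = 0" if i: "i < sum_list ns" for i
  proof -
    obtain l y where ly: "l < length ns" "y < ns ! l" "i = range_start ns l + y"
      using obtain_range[OF i] .
    show ?thesis
      unfolding sum_eq ly(3) block_vec_index[OF ly(1,2)] using a ly by (cases "l = k") simp_all
  qed
  then have "\<forall>v\<in>block_vec ns k ` S. ?b v = 0"
    using indpt_vecsD[OF ind, of ?b] by blast
  then show "\<forall>v\<in>S. a v = 0" using inj by simp
qed

text \<open>Coordinates in range \<open>l\<close> see only vectors embedded from block
  \<open>l\<close>, so a relation on the union splits into one relation per block.\<close>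

lemma sum_UN_block_vec:
  fixes a :: "'a :: field vec \<Rightarrow> 'a"
  assumes S: "\<And>k. k < length ns \<Longrightarrow> finite (S k) \<and> S k \<subseteq> carrier_vec (ns ! k) \<and> 0\<^sub>v (ns ! k) \<notin> S k"
    and l: "l < length ns" "y < ns ! l"
  shows "(\<Sum>v\<in>(\<Union>k<length ns. block_vec ns k ` S k). a v * v $ (range_start ns l + y)) =
    (\<Sum>w\<in>S l. a (block_vec ns l w) * w $ y)"
proof -
  have "(\<Sum>v\<in>(\<Union>k<length ns. block_vec ns k ` S k). a v * v $ (range_start ns l + y)) =
      (\<Sum>v\<in>block_vec ns l ` S l. a v * v $ (range_start ns l + y))"
    using S l by (intro sum.mono_neutral_right) (auto simp: block_vec_index split: if_splits)
  also have "\<dots> = (\<Sum>w\<in>S l. a (block_vec ns l w) * block_vec ns l w $ (range_start ns l + y))"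
    using inj_on_subset[OF inj_on_block_vec[OF l(1)]] S[OF l(1)] by (subst sum.reindex) auto
  finally show ?thesis using l by (simp add: block_vec_index)
qed

text \<open>Gluing the embedded maximal independent column sets of all \<open>B k\<close> yields a
  maximal independent column set of \<open>M\<close>. The glued pieces are pairwise disjoint, so
  their cardinalities add up.\<close>

lemma rank_block_columns:
  fixes M :: "'a :: field mat" and B :: "nat \<Rightarrow> 'a mat"
  assumes M: "M \<in> carrier_mat (sum_list ns) nc"
    and B: "\<And>k. k < length ns \<Longrightarrow> B k \<in> carrier_mat (ns ! k) (nb k)"
    and sub: "\<And>k. k < length ns \<Longrightarrow> block_vec ns k ` set (cols (B k)) \<subseteq> set (cols M)"
    and sup: "set (cols M) \<subseteq> insert (0\<^sub>v (sum_list ns)) (\<Union>k<length ns. block_vec ns k ` set (cols (B k)))"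
  shows "vec_space.rank (sum_list ns) M = (\<Sum>k<length ns. vec_space.rank (ns ! k) (B k))"
proof -
  have "\<forall>k. \<exists>S. k < length ns \<longrightarrow> S \<subseteq> set (cols (B k)) \<and> indpt_vecs (ns ! k) S \<and>
      (\<forall>v\<in>set (cols (B k)). v \<notin> S \<longrightarrow> \<not> indpt_vecs (ns ! k) (insert v S)) \<and>
      vec_space.rank (ns ! k) (B k) = card S"
    using rank_obtain_basis[OF B] by metis
  then obtain S where S: "\<And>k. k < length ns \<Longrightarrow> S k \<subseteq> set (cols (B k))"
    and ind: "\<And>k. k < length ns \<Longrightarrow> indpt_vecs (ns ! k) (S k)"
    and max: "\<And>k v. k < length ns \<Longrightarrow> v \<in> set (cols (B k)) \<Longrightarrow> v \<notin> S k \<Longrightarrow>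
      \<not> indpt_vecs (ns ! k) (insert v (S k))"
    and card: "\<And>k. k < length ns \<Longrightarrow> vec_space.rank (ns ! k) (B k) = card (S k)"
    by metis
  have cB: "set (cols (B k)) \<subseteq> carrier_vec (ns ! k)" if "k < length ns" for k
    using B[OF that] cols_dim[of "B k"] by auto
  have fin: "finite (S k)" if "k < length ns" for k
    using S[OF that] finite_subset by blast
  have nz: "0\<^sub>v (ns ! k) \<notin> S k" if "k < length ns" for k
    using zero_not_in_indpt_vecs ind fin that by blast
  have SC: "S k \<subseteq> carrier_vec (ns ! k)" if "k < length ns" for k
    using S cB that by blast
  have inj: "inj_on (block_vec ns k) (S k)" if "k < length ns" for k
    using inj_on_subset[OF inj_on_block_vec] SC that by blast
  let ?S = "\<Union>k<length ns. block_vec ns k ` S k"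
  have "vec_space.rank (sum_list ns) M = card ?S"
  proof (rule rank_eq_card[OF M])
    show "?S \<subseteq> set (cols M)" using sub S by blast
    show "indpt_vecs (sum_list ns) ?S"
      unfolding indpt_vecs_def
    proof (intro allI impI ballI)
      fix a v assume a: "\<forall>i<sum_list ns. (\<Sum>v\<in>?S. a v * v $ i) = 0" and "v \<in> ?S"
      then obtain k w where k: "k < length ns" "w \<in> S k" "v = block_vec ns k w" by auto
      have "(\<Sum>w\<in>S k. a (block_vec ns k w) * w $ i) = 0" if i: "i < ns ! k" for i
        using a range_start_add_less[OF k(1) i] sum_UN_block_vec[of ns S k i a, OF _ k(1) i]
          fin SC nz by auto
      then show "a v = 0" unfolding k(3)
        by (rule indpt_vecsD[OF ind[OF k(1)], of "\<lambda>w. a (block_vec ns k w)", OF _ k(2)])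
    qed
    fix v assume v: "v \<in> set (cols M)" "v \<notin> ?S"
    show "\<not> indpt_vecs (sum_list ns) (insert v ?S)"
    proof
      assume I: "indpt_vecs (sum_list ns) (insert v ?S)"
      have finS: "finite (insert v ?S)" using fin by auto
      \<comment> \<open>An independent set omits zero, so of the columns allowed by
        \<open>sup\<close> only an embedded column of some \<open>B k\<close> remains.\<close>
      have "v \<noteq> 0\<^sub>v (sum_list ns)" using zero_not_in_indpt_vecs[OF I finS] by auto
      then obtain k w where k: "k < length ns" "w \<in> set (cols (B k))" "v = block_vec ns k w"
        using v(1) sup by auto
      then have "w \<notin> S k" using v(2) by auto
      \<comment> \<open>Dropping the other blocks leaves the embedding of
        \<open>insert w (S k)\<close>; its independence descends to block \<open>k\<close> and
        contradicts the maximality of \<open>S k\<close>.\<close>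
      have "indpt_vecs (sum_list ns) (block_vec ns k ` insert w (S k))"
        by (rule indpt_vecs_subset[OF I _ finS]) (use k in auto)
      then have "indpt_vecs (ns ! k) (insert w (S k))"
        using k SC cB by (intro indpt_vecs_block_vec_imageD) auto
      then show False using max k \<open>w \<notin> S k\<close> by blast
    qed
  qed
  also have "\<dots> = (\<Sum>k<length ns. card (block_vec ns k ` S k))"
  proof (rule card_UN_disjoint)
    show "\<forall>i\<in>{..<length ns}. \<forall>j\<in>{..<length ns}. i \<noteq> j \<longrightarrow>
        block_vec ns i ` S i \<inter> block_vec ns j ` S j = {}"
    \<comment> \<open>A common element would be embedded from two different blocks, which is
      impossible as \<open>S i\<close> omits zero.\<close>
    proof (intro ballI impI equals0I)
      fix i j v assume ij: "i \<in> {..<length ns}" "j \<in> {..<length ns}" "i \<noteq> j"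
        and "v \<in> block_vec ns i ` S i \<inter> block_vec ns j ` S j"
      then obtain x y where "x \<in> S i" "y \<in> S j" "block_vec ns i x = block_vec ns j y" by auto
      then show False
        using block_vec_inj[of i ns j x y] ij SC nz by (metis lessThan_iff subsetD)
    qed
  qed (use fin in auto)
  also have "\<dots> = (\<Sum>k<length ns. vec_space.rank (ns ! k) (B k))"
    using card card_image[OF inj] by (intro sum.cong) auto
  finally show ?thesis .
qed

section \<open>Fibres of a tensor\<close>

text \<open>Multi-indices with an arbitrary entry in position \<open>k\<close>, so that a mode-\<open>k\<close> fibre has an index
  even if the dimension in mode \<open>k\<close> is 0.\<close>

definition fibre_set :: "nat \<Rightarrow> nat list \<Rightarrow> nat list set" where
  "fibre_set k ns = {i. length i = length ns \<and> (\<forall>l < length ns. l \<noteq> k \<longrightarrow> i ! l < ns ! l)}"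

lemma fibre_set_update: "i \<in> fibre_set k ns \<Longrightarrow> k < length ns \<Longrightarrow> x < ns ! k \<Longrightarrow> i[k := x] \<in> index_set ns"
  by (auto simp: fibre_set_def index_set_def nth_list_update)

lemma delete_nth_update: "delete_nth k (i[k := x]) = delete_nth k i"
  by (simp add: delete_nth_def)

definition fibre :: "nat \<Rightarrow> 'a tensor \<Rightarrow> nat list \<Rightarrow> 'a vec" where
  "fibre k A i = vec (dims A ! k) (\<lambda>x. entry A (i[k := x]))"

lemma delete_nth_image_fibre_set:
  assumes k: "k < length ns"
  shows "delete_nth k ` fibre_set k ns = index_set (delete_nth k ns)"
proof (intro equalityI subsetI)
  fix j assume "j \<in> delete_nth k ` fibre_set k ns"
  then show "j \<in> index_set (delete_nth k ns)"
    using k by (auto simp: fibre_set_def index_set_def delete_nth_def nth_append)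
next
  fix j assume j: "j \<in> index_set (delete_nth k ns)"
  \<comment> \<open>Any value may be inserted at position \<open>k\<close>, since
    \<open>fibre_set\<close> does not bound that entry; 0 therefore works even if
    \<open>ns ! k\<close> is 0.\<close>
  let ?i = "take k j @ 0 # drop k j"
  have lj: "length j = length ns - 1"
    using j k by (auto simp: index_set_def delete_nth_def)
  have jl: "j ! l < delete_nth k ns ! l" if "l < length ns - 1" for l
    using j that lj by (auto simp: index_set_def)
  have "delete_nth k ?i = j" using lj k by (simp add: delete_nth_def)
  moreover have "?i \<in> fibre_set k ns"
  proof -
    have "?i ! l < ns ! l" if l: "l < length ns" "l \<noteq> k" for l
    proof (cases "l < k")
      case True
      then show ?thesis using jl[of l] lj k l by (simp add: nth_append delete_nth_def)
    next
      case False
      \<comment> \<open>Beyond the inserted entry, positions are shifted by one against those of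
        \<open>j\<close>.\<close>
      then obtain l' where l': "l = Suc l'" "k \<le> l'" using l by (cases l) auto
      then show ?thesis using jl[of l'] lj k l
        by (simp add: nth_append delete_nth_def nth_Cons' min_def)
    qed
    then show ?thesis using lj k by (simp add: fibre_set_def)
  qed
  ultimately show "j \<in> delete_nth k ` fibre_set k ns" by (metis imageI)
qed

text \<open>\<open>ivec\<close> numbers the columns by the multi-indices with mode \<open>k\<close>
  deleted, so column numbers can be traded for fibres and the numbering drops out of the rank
  computation.\<close>

lemma set_cols_unfolding_mat:
  assumes k: "k < length (dims A)"
  shows "set (cols (unfolding_mat k A)) = fibre k A ` fibre_set k (dims A)"
proof -
  let ?ns = "dims A"
  let ?col = "\<lambda>i. ivec (delete_nth k i) (delete_nth k ?ns)"
  have cols: "?col ` fibre_set k ?ns = {..<prod_list (delete_nth k ?ns)}"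
    using bij_betw_imp_surj_on[OF bij_betw_ivec[of "delete_nth k ?ns"]]
    unfolding delete_nth_image_fibre_set[OF k, symmetric] image_image .
  have dim: "dim_row (unfolding_mat k A) = ?ns ! k"
    "dim_col (unfolding_mat k A) = prod_list (delete_nth k ?ns)"
    by (simp_all add: unfolding_mat_def Let_def)
  have col: "col (unfolding_mat k A) (?col i) = fibre k A i" if i: "i \<in> fibre_set k ?ns" for i
  proof (rule eq_vecI)
    fix x assume "x < dim_vec (fibre k A i)"
    then have x: "x < ?ns ! k" by (simp add: fibre_def)
    have "?col i < dim_col (unfolding_mat k A)" using i cols dim by auto
    then show "col (unfolding_mat k A) (?col i) $ x = fibre k A i $ x"
      using unfolding_mat_index[OF fibre_set_update[OF i k x] k] x dim i k
      by (simp add: delete_nth_update fibre_def fibre_set_def)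
  qed (simp add: dim fibre_def)
  have "set (cols (unfolding_mat k A)) = col (unfolding_mat k A) ` {..<dim_col (unfolding_mat k A)}"
    by (auto simp: cols_def)
  also have "\<dots> = (\<lambda>i. col (unfolding_mat k A) (?col i)) ` fibre_set k ?ns"
    unfolding dim(2) cols[symmetric] by (simp add: image_image)
  also have "\<dots> = fibre k A ` fibre_set k ?ns"
    using col by (intro image_cong) auto
  finally show ?thesis .
qed

section \<open>Fibres of the symmetric embedding\<close>

lemma length_is_perm: "is_perm d p \<Longrightarrow> length p = d"
  by (metis card_lessThan distinct_card is_perm_def)

lemma is_perm_nth_less: "is_perm d p \<Longrightarrow> t < d \<Longrightarrow> p ! t < d"
  using length_is_perm[of d p] nth_mem[of t p] by (auto simp: is_perm_def)

lemma is_perm_nth_eq_iff: "is_perm d p \<Longrightarrow> t < d \<Longrightarrow> u < d \<Longrightarrow> p ! t = p ! u \<longleftrightarrow> t = u"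
  using length_is_perm[of d p] by (simp add: is_perm_def nth_eq_iff_index_eq)

text \<open>Block \<open>p\<close> holds the transpose by \<open>p\<close>, and reading it at the
  index permuted by \<open>p\<close> undoes the transposition.\<close>

lemma entry_sym_embedding_perm:
  assumes p: "is_perm (length (dims A)) p" and i: "i \<in> index_set (dims A)"
  shows "entry (sym_embedding A) (map (\<lambda>k. range_start (dims A) k + i ! k) p) = entry A i"
proof -
  have *: "map (\<lambda>k. range_start (dims A) k + i ! k) p =
      map2 (\<lambda>k x. range_start (dims A) k + x) p (map (\<lambda>k. i ! k) p)"
    by (induction p) auto
  have "map (\<lambda>k. i ! k) p \<in> index_set (map (\<lambda>k. dims A ! k) p)"
    using p i is_perm_nth_less[OF p] length_is_perm[OF p] by (simp add: index_set_def)
  then show ?thesis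
    unfolding * using p i length_is_perm[OF p]
    by (subst entry_sym_embedding) (auto simp: entry_tensor_transpose is_perm_def)
qed

lemma entry_sym_embedding_not_perm:
  assumes "c \<in> index_set (replicate (length (dims A)) (sum_list (dims A)))"
    and "\<not> is_perm (length (dims A)) (map (range_of (dims A)) c)"
  shows "entry (sym_embedding A) c = 0"
  using assms by (simp add: sym_embedding_def Let_def)

text \<open>The other entries of a permutation leave exactly one value for position
  \<open>m\<close>.\<close>

lemma is_perm_update_iff:
  assumes p: "is_perm d p" and m: "m < d"
  shows "is_perm d (p[m := l]) \<longleftrightarrow> l = p ! m"
proof
  assume q: "is_perm d (p[m := l])"
  show "l = p ! m"
  proof (rule ccontr)
    assume ne: "l \<noteq> p ! m"
    have len: "length p = d" using length_is_perm p .
    have "l \<in> set (p[m := l])" using len m by (simp add: set_update_memI)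
    \<comment> \<open>\<open>p\<close> already takes every value, so \<open>l\<close> sits at some
      \<open>t\<close> other than \<open>m\<close> and would occur twice after the update.\<close>
    then have "l \<in> set p" using p q by (simp add: is_perm_def)
    then obtain t where t: "t < d" "p ! t = l" using len by (metis in_set_conv_nth)
    then have "t \<noteq> m" using ne by auto
    then have "p[m := l] ! t = p[m := l] ! m" using t m len by simp
    then show False using is_perm_nth_eq_iff[OF q t(1) m] \<open>t \<noteq> m\<close> by simp
  qed
qed (use p in simp)

text \<open>If the blocks in the modes other than \<open>m\<close> form a permutation with only \<open>p ! m\<close> missing, then the
  mode-\<open>m\<close> fibre through them meets a single nonzero block.\<close>

lemma fibre_sym_embedding_perm:
  assumes p: "is_perm (length (dims A)) p" and m: "m < length (dims A)"
    and i: "i \<in> fibre_set (p ! m) (dims A)"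
    and c: "c \<in> fibre_set m (replicate (length (dims A)) (sum_list (dims A)))"
    and eq: "\<And>t. t < length (dims A) \<Longrightarrow> t \<noteq> m \<Longrightarrow> c ! t = range_start (dims A) (p ! t) + i ! (p ! t)"
  shows "fibre m (sym_embedding A) c = block_vec (dims A) (p ! m) (fibre (p ! m) A i)"
proof (rule block_vec_eqI)
  let ?ns = "dims A" and ?d = "length (dims A)"
  show "dim_vec (fibre m (sym_embedding A) c) = sum_list ?ns" using m by (simp add: fibre_def)
  fix l x assume l: "l < ?d" and x: "x < ?ns ! l"
  let ?y = "range_start ?ns l + x"
  have y: "?y < sum_list ?ns" using range_start_add_less[OF l x] .
  have len: "length p = ?d" "length c = ?d" "length i = ?d"
    using length_is_perm[OF p] c i by (auto simp: fibre_set_def)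
  have pt: "p ! t < ?d" if "t < ?d" for t
    using is_perm_nth_less[OF p that] .
  have ne: "p ! t \<noteq> p ! m" if "t < ?d" "t \<noteq> m" for t
    using is_perm_nth_eq_iff[OF p] m that by simp
  have it: "i ! (p ! t) < ?ns ! (p ! t)" if "t < ?d" "t \<noteq> m" for t
    using i pt[OF that(1)] ne[OF that] by (auto simp: fibre_set_def)
  have L: "fibre m (sym_embedding A) c $ ?y = entry (sym_embedding A) (c[m := ?y])"
    using y m by (simp add: fibre_def)
  show "fibre m (sym_embedding A) c $ ?y = (if l = p ! m then fibre (p ! m) A i $ x else 0)"
  proof (cases "l = p ! m")
    case True
    let ?i = "i[l := x]"
    \<comment> \<open>The block met is \<open>p\<close> itself, where the embedding reproduces the
      entries of \<open>A\<close>.\<close>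
    have "c[m := ?y] = map (\<lambda>k. range_start ?ns k + ?i ! k) p"
    proof (rule nth_equalityI)
      fix t assume "t < length (c[m := ?y])"
      then show "c[m := ?y] ! t = map (\<lambda>k. range_start ?ns k + ?i ! k) p ! t"
        using True len l eq[of t] ne[of t] by (cases "t = m") auto
    qed (use len in simp)
    moreover have "?i \<in> index_set ?ns" using fibre_set_update i l x True by blast
    ultimately show ?thesis
      using L True x entry_sym_embedding_perm[OF p] by (simp add: fibre_def)
  next
    case False
    \<comment> \<open>The block met is \<open>p\<close> altered at position \<open>m\<close>; this
      is not a permutation, so the entry is zero.\<close>
    have "map (range_of ?ns) (c[m := ?y]) = p[m := l]"
    proof (rule nth_equalityI)
      fix t assume "t < length (map (range_of ?ns) (c[m := ?y]))"
      then show "map (range_of ?ns) (c[m := ?y]) ! t = p[m := l] ! t"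
        using len l x eq[of t] range_of_eq[OF pt it, of t] range_of_eq[OF l x] by (cases "t = m") auto
    qed (use len in simp)
    moreover have "c[m := ?y] \<in> index_set (replicate ?d (sum_list ?ns))"
      using c m y by (intro fibre_set_update) auto
    ultimately show ?thesis
      using L False is_perm_update_iff[OF p m] by (simp add: entry_sym_embedding_not_perm)
  qed
qed

text \<open>Whichever range is entered in mode \<open>m\<close>, the ranges fixed in the other modes
  rule out a permutation, so the fibre runs through zero blocks only.\<close>

lemma fibre_sym_embedding_not_perm:
  assumes m: "m < length (dims A)"
    and c: "c \<in> fibre_set m (replicate (length (dims A)) (sum_list (dims A)))"
    and np: "\<And>l. \<not> is_perm (length (dims A)) ((map (range_of (dims A)) c)[m := l])"
  shows "fibre m (sym_embedding A) c = 0\<^sub>v (sum_list (dims A))"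
proof (rule eq_vecI)
  fix x assume "x < dim_vec (0\<^sub>v (sum_list (dims A)))"
  moreover from this have "c[m := x] \<in> index_set (replicate (length (dims A)) (sum_list (dims A)))"
    using c m by (intro fibre_set_update) auto
  ultimately show "fibre m (sym_embedding A) c $ x = 0\<^sub>v (sum_list (dims A)) $ x"
    using m np by (simp add: fibre_def entry_sym_embedding_not_perm map_update)
qed (use m in \<open>simp add: fibre_def\<close>)

lemma exists_perm_nth:
  assumes "m < d" "k < d"
  obtains p where "is_perm d p" "p ! m = k"
proof -
  let ?p = "map (Transposition.transpose m k) [0..<d]"
  have "Transposition.transpose m k ` {..<d} = {..<d}"
    using assms by (intro transpose_image_eq) auto
  then have "is_perm d ?p" "?p ! m = k"
    using assms by (auto simp: is_perm_def distinct_map atLeast0LessThan)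
  then show ?thesis using that by blast
qed

text \<open>A permutation with \<open>k\<close> at position \<open>m\<close> leads a
  mode-\<open>m\<close> fibre through block \<open>k\<close>, while the other modes carry the
  remaining entries of \<open>i\<close>.\<close>

lemma block_vec_fibre_in_fibres:
  assumes m: "m < length (dims A)" and k: "k < length (dims A)" and i: "i \<in> fibre_set k (dims A)"
  shows "block_vec (dims A) k (fibre k A i) \<in>
    fibre m (sym_embedding A) ` fibre_set m (replicate (length (dims A)) (sum_list (dims A)))"
proof -
  let ?ns = "dims A" and ?d = "length (dims A)"
  obtain p where p: "is_perm ?d p" "p ! m = k" using exists_perm_nth[OF m k] .
  let ?c = "map (\<lambda>k. range_start ?ns k + i ! k) p"
  have len: "length p = ?d" using length_is_perm[OF p(1)] .
  have "?c ! t < sum_list ?ns" if t: "t < ?d" "t \<noteq> m" for t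
  proof -
    have "p ! t < ?d" using is_perm_nth_less[OF p(1) t(1)] .
    moreover have "p ! t \<noteq> k" using is_perm_nth_eq_iff[OF p(1)] p(2) m t by auto
    ultimately show ?thesis
      using i t len by (auto simp: fibre_set_def intro: range_start_add_less)
  qed
  then have c: "?c \<in> fibre_set m (replicate ?d (sum_list ?ns))"
    using len by (simp add: fibre_set_def)
  have eq: "fibre m (sym_embedding A) ?c = block_vec ?ns (p ! m) (fibre (p ! m) A i)"
    by (rule fibre_sym_embedding_perm[OF p(1) m _ c]) (use i p(2) len in simp_all)
  show ?thesis
    using imageI[OF c, of "fibre m (sym_embedding A)"] unfolding eq p(2) .
qed

text \<open>Either the ranges outside mode \<open>m\<close> complete to a permutation, whose value
  at \<open>m\<close> names the block, or they never do and the fibre is zero.\<close>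

lemma fibre_sym_embedding_cases:
  assumes m: "m < length (dims A)"
    and c: "c \<in> fibre_set m (replicate (length (dims A)) (sum_list (dims A)))"
  shows "fibre m (sym_embedding A) c \<in> insert (0\<^sub>v (sum_list (dims A)))
    (\<Union>k<length (dims A). block_vec (dims A) k ` fibre k A ` fibre_set k (dims A))"
proof -
  let ?ns = "dims A" and ?d = "length (dims A)"
  show ?thesis
  proof (cases "\<exists>l. is_perm ?d ((map (range_of ?ns) c)[m := l])")
    case True
    then obtain l where p: "is_perm ?d ((map (range_of ?ns) c)[m := l])" by blast
    define p where "p = (map (range_of ?ns) c)[m := l]"
    note p = p[folded p_def]
    have lc: "length c = ?d" using c by (simp add: fibre_set_def)
    have len: "length p = ?d" using length_is_perm[OF p] .
    have pm: "p ! m = l" using m lc by (simp add: p_def)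
    have l: "l < ?d" using is_perm_nth_less[OF p m] pm by simp
    \<comment> \<open>This undoes permutation and shift: entry \<open>q\<close> is the offset of
      \<open>c ! t\<close> in range \<open>q\<close>, for the \<open>t\<close> with
      \<open>p ! t = q\<close>. At \<open>q = l\<close> it comes from the free entry
      \<open>c ! m\<close>, which \<open>fibre_set l\<close> leaves unbounded.\<close>
    define i where "i = map (\<lambda>q. c ! (THE t. t < ?d \<and> p ! t = q) - range_start ?ns q) [0..<?d]"
    have the: "(THE t'. t' < ?d \<and> p ! t' = p ! t) = t" if "t < ?d" for t
      using that is_perm_nth_eq_iff[OF p] by (intro the_equality) auto
    have pt: "p ! t < ?d" if "t < ?d" for t
      using is_perm_nth_less[OF p that] .
    have i_nth: "i ! (p ! t) = c ! t - range_start ?ns (p ! t)" if "t < ?d" for t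
      using that pt the by (simp add: i_def)
    have ci: "c ! t = range_start ?ns (p ! t) + i ! (p ! t) \<and> i ! (p ! t) < ?ns ! (p ! t)"
      if t: "t < ?d" "t \<noteq> m" for t
    proof -
      have "c ! t < sum_list ?ns" using c t by (simp add: fibre_set_def)
      then obtain q y where q: "q < ?d" "y < ?ns ! q" "c ! t = range_start ?ns q + y"
        using obtain_range by blast
      then have "p ! t = q" using t lc by (simp add: p_def range_of_eq)
      then show ?thesis using q i_nth[OF t(1)] by simp
    qed
    have i: "i \<in> fibre_set l ?ns"
      unfolding fibre_set_def
    proof (intro CollectI conjI allI impI)
      fix q assume q: "q < ?d" "q \<noteq> l"
      then have "q \<in> set p" using p by (simp add: is_perm_def)
      then obtain t where "t < ?d" "p ! t = q" using len by (metis in_set_conv_nth)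
      then show "i ! q < ?ns ! q" using ci q pm by metis
    qed (simp add: i_def)
    have "fibre m (sym_embedding A) c = block_vec ?ns l (fibre l A i)"
      using fibre_sym_embedding_perm[OF p m _ c, of i] i ci by (simp add: pm)
    then show ?thesis using l i by blast
  next
    case False
    then show ?thesis using fibre_sym_embedding_not_perm[OF m c] by auto
  qed
qed

text \<open>Up to zero columns, the unfolding in any mode \<open>m\<close> has the same columns,
  namely all embedded fibres of \<open>A\<close>; hence the sum does not depend on
  \<open>m\<close>.\<close>

lemma rank_unfolding_sym_embedding:
  assumes m: "m < length (dims A)"
  shows "vec_space.rank (sum_list (dims A)) (unfolding_mat m (sym_embedding A)) =
    (\<Sum>k<length (dims A). vec_space.rank (dims A ! k) (unfolding_mat k A))"
proof (rule rank_block_columns)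
  show "unfolding_mat m (sym_embedding A) \<in> carrier_mat (sum_list (dims A))
      (prod_list (delete_nth m (dims (sym_embedding A))))"
    using m by (simp add: unfolding_mat_def Let_def)
  show "unfolding_mat k A \<in> carrier_mat (dims A ! k) (prod_list (delete_nth k (dims A)))" for k
    by (simp add: unfolding_mat_def Let_def)
  show "block_vec (dims A) k ` set (cols (unfolding_mat k A)) \<subseteq>
      set (cols (unfolding_mat m (sym_embedding A)))" if "k < length (dims A)" for k
    using block_vec_fibre_in_fibres[OF m that] m that by (auto simp: set_cols_unfolding_mat)
  show "set (cols (unfolding_mat m (sym_embedding A))) \<subseteq> insert (0\<^sub>v (sum_list (dims A)))
      (\<Union>k<length (dims A). block_vec (dims A) k ` set (cols (unfolding_mat k A)))"
    using fibre_sym_embedding_cases[OF m] m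
    by (simp add: set_cols_unfolding_mat image_subset_iff)
qed

theorem theorem6p1:
  fixes A :: "real tensor" and ns rs :: "nat list"
  assumes "dims A = ns"
    and "multilinear_rank A = rs"
  shows "multilinear_rank (sym_embedding A) = replicate (length ns) (sum_list rs)"
proof (rule nth_equalityI)
  fix m assume "m < length (multilinear_rank (sym_embedding A))"
  then show "multilinear_rank (sym_embedding A) ! m = replicate (length ns) (sum_list rs) ! m"
    using assms rank_unfolding_sym_embedding[of m A]
    by (auto simp: multilinear_rank_def interv_sum_list_conv_sum_set_nat atLeast0LessThan)
qed (use assms in \<open>simp add: multilinear_rank_def\<close>)

end
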